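(* Let $m,n,r$ be positive integers. The number $M(m,n,r)$ of $m\times n$ $(0,1)$-matrices with exactly $r$ entries equal to $1$ and no zero row or column is given by $$M(m,n,r)=\sum_{l\geq r}\ \sum_{d\mid l}(-1)^{n+m-(d+l/d)}\binom{m}{d}\binom{n}{l/d}\binom{l}{r}.$$
   Context: The inner sum is over the positive divisors $d$ of $l$. The binomial coefficient $\binom{a}{b}$ is $0$ when $b>a$, so the sum is finite. *)

theory Defs
  imports "Jordan_Normal_Form.Matrix" "HOL-Analysis.Infinite_Sum"
begin

definition binary_matrices :: "nat \<Rightarrow> nat \<Rightarrow> nat \<Rightarrow> int mat set" where
  "binary_matrices m n r = {A \<in> carrier_mat m n.
     elements_mat A \<subseteq> {0, 1} \<and>
     card {(i, j). i < m \<and> j < n \<and> A $$ (i, j) = 1} = r \<and>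
     (\<forall>i<m. row A i \<noteq> 0\<^sub>v n) \<and>
     (\<forall>j<n. col A j \<noteq> 0\<^sub>v m)}"

definition M :: "nat \<Rightarrow> nat \<Rightarrow> nat \<Rightarrow> nat" where
  "M m n r = card (binary_matrices m n r)"

end

theory Submission
  imports Defs
begin

text \<open>
  A \<open>0\<close>-\<open>1\<close> matrix is the same thing as the set \<open>S\<close> of positions of its ones, a relation between
  row indices and column indices. No row vanishes iff the first projection of \<open>S\<close> is the set of all
  row indices, and likewise for columns and the second projection (\<open>M_eq_card_relations\<close>).

  Relations with \<open>r\<close> elements whose projections are merely \<^emph>\<open>contained\<close> in \<open>T\<close> and \<open>U\<close> are the
  \<open>r\<close>-subsets of \<open>T \<times> U\<close>, so there are \<open>(card T * card U) choose r\<close> of them. Moebius inversion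
  over the subsets of the rows and then over the subsets of the columns turns containment into
  equality (\<open>card_relations_full_projections\<close>). The terms depend only on the sizes \<open>d\<close> and \<open>e\<close> of
  the two subsets, which gives a double sum over \<open>d \<le> m\<close>, \<open>e \<le> n\<close>.

  Collecting the terms with the same product \<open>l = d * e\<close> gives the sum over the divisors of \<open>l\<close>
  (\<open>sum_box_eq_sum_divisors\<close>): as \<open>r > 0\<close>, the terms with \<open>l < r\<close>, in particular those with
  \<open>l = 0\<close>, vanish because of \<open>l choose r\<close>. For \<open>l > m * n\<close> every factorisation of \<open>l\<close> has \<open>d > m\<close>
  or \<open>l div d > n\<close>, so the infinite sum has finite support.
\<close>

lemma card_partition_by_image:
  assumes "finite \<X>" and "finite U" and "\<And>S. S \<in> \<X> \<Longrightarrow> h S \<subseteq> U"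
  shows "card \<X> = (\<Sum>T\<in>Pow U. card {S \<in> \<X>. h S = T})"
proof -
  have "h ` \<X> \<subseteq> Pow U"
    using assms(3) by blast
  then show ?thesis
    using sum.group[of \<X> "Pow U" h "\<lambda>_. 1::nat"] assms(1,2) by simp
qed

text \<open>
  The count of the \<open>S\<close> with \<open>h S \<subseteq> U\<close> is the sum of the counts with \<open>h S = T\<close> over \<open>T \<subseteq> U\<close>, so
  inclusion-exclusion recovers the latter. The counts are finite although \<open>\<X>\<close> may not be, as for
  the relations of a given size on infinite types.
\<close>

lemma moebius_card:
  fixes h :: "'b \<Rightarrow> 'a set"
  assumes fin: "\<And>U. finite U \<Longrightarrow> finite {S \<in> \<X>. h S \<subseteq> U}" and "finite U"
  shows "real (card {S \<in> \<X>. h S = U}) =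
    (\<Sum>T\<in>Pow U. (-1) ^ (card U - card T) * real (card {S \<in> \<X>. h S \<subseteq> T}))"
proof (rule inclusion_exclusion_mobius[OF _ \<open>finite U\<close>])
  fix U :: "'a set"
  assume U: "finite U"
  have "card {S \<in> \<X>. h S \<subseteq> U} = (\<Sum>T\<in>Pow U. card {S \<in> {S \<in> \<X>. h S \<subseteq> U}. h S = T})"
    using fin[OF U] U by (intro card_partition_by_image) auto
  also have "\<dots> = (\<Sum>T\<in>Pow U. card {S \<in> \<X>. h S = T})"
    by (intro sum.cong refl arg_cong[where f = card]) auto
  finally show "real (card {S \<in> \<X>. h S \<subseteq> U}) = (\<Sum>T\<in>Pow U. real (card {S \<in> \<X>. h S = T}))"
    by simp
qed

text \<open>
  Moebius inversion is used for the first projection with the second one fixed, and then for the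
  second one inside each term. It ends in the condition that both projections lie in given sets,
  which just says that \<open>S\<close> lies in their product.
\<close>

lemma card_relations_full_projections:
  fixes R :: "'a set" and C :: "'b set"
  assumes "finite R" and "finite C"
  shows "real (card {S. card S = r \<and> fst ` S = R \<and> snd ` S = C}) =
    (\<Sum>T\<in>Pow R. \<Sum>U\<in>Pow C. (-1) ^ (card R - card T) * (-1) ^ (card C - card U) *
       real ((card T * card U) choose r))"
proof -
  have fin: "finite {S. fst ` S \<subseteq> T \<and> snd ` S \<subseteq> U}" if "finite T" "finite U" for T :: "'a set" and U :: "'b set"
    by (rule finite_subset[of _ "Pow (T \<times> U)"]) (use that in force)+
  have "real (card {S. card S = r \<and> fst ` S = R \<and> snd ` S = C}) =
      real (card {S \<in> {S. card S = r \<and> snd ` S = C}. fst ` S = R})"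
    by (intro arg_cong[where f = "\<lambda>X. real (card X)"]) auto
  also have "\<dots> = (\<Sum>T\<in>Pow R. (-1) ^ (card R - card T) *
      real (card {S \<in> {S. card S = r \<and> snd ` S = C}. fst ` S \<subseteq> T}))"
  proof (rule moebius_card[OF _ \<open>finite R\<close>])
    show "finite {S \<in> {S. card S = r \<and> snd ` S = C}. fst ` S \<subseteq> T}" if "finite T" for T :: "'a set"
      by (rule finite_subset[OF _ fin[OF that \<open>finite C\<close>]]) blast
  qed
  also have "\<dots> = (\<Sum>T\<in>Pow R. \<Sum>U\<in>Pow C. (-1) ^ (card R - card T) * (-1) ^ (card C - card U) *
       real ((card T * card U) choose r))"
  proof (rule sum.cong[OF refl])
    fix T
    assume "T \<in> Pow R"
    then have T: "finite T"
      using assms finite_subset by auto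
    have "real (card {S \<in> {S. card S = r \<and> snd ` S = C}. fst ` S \<subseteq> T}) =
        real (card {S \<in> {S. card S = r \<and> fst ` S \<subseteq> T}. snd ` S = C})"
      by (intro arg_cong[where f = "\<lambda>X. real (card X)"]) auto
    also have "\<dots> = (\<Sum>U\<in>Pow C. (-1) ^ (card C - card U) *
      real (card {S \<in> {S. card S = r \<and> fst ` S \<subseteq> T}. snd ` S \<subseteq> U}))"
    proof (rule moebius_card[OF _ \<open>finite C\<close>])
      show "finite {S \<in> {S. card S = r \<and> fst ` S \<subseteq> T}. snd ` S \<subseteq> U}" if "finite U" for U :: "'b set"
        by (rule finite_subset[OF _ fin[OF T that]]) blast
    qed
    also have "\<dots> = (\<Sum>U\<in>Pow C. (-1) ^ (card C - card U) * real ((card T * card U) choose r))"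
    proof (rule sum.cong[OF refl])
      fix U
      assume "U \<in> Pow C"
      then have U: "finite U"
        using assms finite_subset by auto
      have "{S \<in> {S. card S = r \<and> fst ` S \<subseteq> T}. snd ` S \<subseteq> U} = {S. S \<subseteq> T \<times> U \<and> card S = r}"
        by force
      then show "(-1) ^ (card C - card U) * real (card {S \<in> {S. card S = r \<and> fst ` S \<subseteq> T}. snd ` S \<subseteq> U}) =
          (-1) ^ (card C - card U) * real ((card T * card U) choose r)"
        using n_subsets[of "T \<times> U" r] T U by (simp add: card_cartesian_product)
    qed
    finally show "(-1) ^ (card R - card T) *
        real (card {S \<in> {S. card S = r \<and> snd ` S = C}. fst ` S \<subseteq> T}) =
      (\<Sum>U\<in>Pow C. (-1) ^ (card R - card T) * (-1) ^ (card C - card U) *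
       real ((card T * card U) choose r))"
      by (simp add: sum_distrib_left mult.assoc)
  qed
  finally show ?thesis .
qed

lemma sum_Pow_by_card:
  fixes g :: "nat \<Rightarrow> real"
  assumes "finite A"
  shows "(\<Sum>T\<in>Pow A. g (card T)) = (\<Sum>d\<le>card A. real (card A choose d) * g d)"
proof -
  have "(\<Sum>T\<in>Pow A. g (card T)) = (\<Sum>d\<le>card A. \<Sum>T\<in>{T \<in> Pow A. card T = d}. g (card T))"
    using assms by (intro sum.group[symmetric]) (auto intro: card_mono)
  also have "\<dots> = (\<Sum>d\<le>card A. real (card A choose d) * g d)"
    using n_subsets[OF assms] by (intro sum.cong refl) simp
  finally show ?thesis .
qed

text \<open>
  The support of a matrix and the indicator matrix of a set of positions are inverse to each other:
  in one direction because all entries are \<open>0\<close> or \<open>1\<close>, in the other because the projections bound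
  the positions.
\<close>

lemma M_eq_card_relations:
  "M m n r = card {S. card S = r \<and> fst ` S = {..<m} \<and> snd ` S = {..<n}}"
proof -
  let ?supp = "\<lambda>A. {(i, j). i < m \<and> j < n \<and> A $$ (i, j) = (1::int)}"
  let ?ind = "\<lambda>S. mat m n (\<lambda>p. if p \<in> S then 1 else (0::int))"
  let ?Y = "{S. card S = r \<and> fst ` S = {..<m} \<and> snd ` S = {..<n}}"
  have row_nonzero: "row A i \<noteq> 0\<^sub>v n \<longleftrightarrow> (\<exists>j<n. A $$ (i, j) \<noteq> 0)"
    if "A \<in> carrier_mat m n" "i < m" for A :: "int mat" and i
    using that by (auto simp: vec_eq_iff)
  have col_nonzero: "col A j \<noteq> 0\<^sub>v m \<longleftrightarrow> (\<exists>i<m. A $$ (i, j) \<noteq> 0)"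
    if "A \<in> carrier_mat m n" "j < n" for A :: "int mat" and j
    using that by (auto simp: vec_eq_iff)
  have entries: "A $$ (i, j) = 0 \<or> A $$ (i, j) = 1"
    if "A \<in> binary_matrices m n r" "i < m" "j < n" for A i j
    using that by (auto simp: binary_matrices_def)
  have bounds: "i < m \<and> j < n" if "S \<in> ?Y" "(i, j) \<in> S" for S i j
  proof -
    have "fst (i, j) \<in> fst ` S" "snd (i, j) \<in> snd ` S"
      using that(2) by (rule imageI)+
    then show ?thesis
      using that(1) by simp
  qed
  have supp_ind: "?supp (?ind S) = S" if "S \<in> ?Y" for S
    using bounds[OF that] by (auto split: if_splits)
  have "bij_betw ?supp (binary_matrices m n r) ?Y"
  proof (rule bij_betw_byWitness[where f' = ?ind])
    show "\<forall>A\<in>binary_matrices m n r. ?ind (?supp A) = A"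
    proof
      fix A assume A: "A \<in> binary_matrices m n r"
      then have "A \<in> carrier_mat m n"
        by (simp add: binary_matrices_def)
      then show "?ind (?supp A) = A"
        using entries[OF A] by (intro eq_matI) auto
    qed
    show "\<forall>S\<in>?Y. ?supp (?ind S) = S"
      by (intro ballI supp_ind)
    show "?supp ` binary_matrices m n r \<subseteq> ?Y"
    proof (rule image_subsetI)
      fix A assume A: "A \<in> binary_matrices m n r"
      then have carr: "A \<in> carrier_mat m n"
        by (simp add: binary_matrices_def)
      have rows: "\<exists>j<n. A $$ (i, j) = 1" if "i < m" for i
        using A row_nonzero[OF carr that] entries[OF A that] that
        by (auto simp: binary_matrices_def)
      have cols: "\<exists>i<m. A $$ (i, j) = 1" if "j < n" for j
        using A col_nonzero[OF carr that] entries[OF A _ that] that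
        by (auto simp: binary_matrices_def)
      have "fst ` ?supp A = {..<m}" "snd ` ?supp A = {..<n}"
        using rows cols by (force simp: image_iff)+
      then show "?supp A \<in> ?Y"
        using A by (simp add: binary_matrices_def)
    qed
    show "?ind ` ?Y \<subseteq> binary_matrices m n r"
    proof (rule image_subsetI)
      fix S assume S: "S \<in> ?Y"
      have carr: "?ind S \<in> carrier_mat m n"
        by simp
      have card: "card (?supp (?ind S)) = r"
        unfolding supp_ind[OF S] using S by simp
      have rows: "row (?ind S) i \<noteq> 0\<^sub>v n" if "i < m" for i
      proof -
        have "i \<in> fst ` S" using S that by simp
        then obtain j where "(i, j) \<in> S" by force
        then show ?thesis
          unfolding row_nonzero[OF carr that] using bounds[OF S] by (intro exI[of _ j]) simp
      qed
      have cols: "col (?ind S) j \<noteq> 0\<^sub>v m" if "j < n" for j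
      proof -
        have "j \<in> snd ` S" using S that by simp
        then obtain i where "(i, j) \<in> S" by force
        then show ?thesis
          unfolding col_nonzero[OF carr that] using bounds[OF S] by (intro exI[of _ i]) simp
      qed
      have elems: "elements_mat (?ind S) \<subseteq> {0, 1}"
        by (auto dest!: elements_matD split: if_splits)
      show "?ind S \<in> binary_matrices m n r"
        unfolding binary_matrices_def mem_Collect_eq
        by (intro conjI allI impI carr elems card rows cols)
    qed
  qed
  then show ?thesis
    unfolding M_def by (rule bij_betw_same_card)
qed

text \<open>
  The pairs \<open>(d, e)\<close> with \<open>d * e = l > 0\<close> correspond to the divisors \<open>d\<close> of \<open>l\<close>. The box
  \<open>d \<le> m\<close>, \<open>e \<le> n\<close> and the region \<open>r \<le> d * e \<le> m * n\<close> differ, but \<open>f\<close> vanishes on the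
  difference. The bound \<open>r > 0\<close> matters: it excludes \<open>l = 0\<close>, which every \<open>d\<close> divides.
\<close>

lemma sum_box_eq_sum_divisors:
  fixes f :: "nat \<Rightarrow> nat \<Rightarrow> real"
  assumes "r > 0"
    and small: "\<And>d e. d * e < r \<Longrightarrow> f d e = 0"
    and large: "\<And>d e. d > m \<or> e > n \<Longrightarrow> f d e = 0"
  shows "(\<Sum>d\<le>m. \<Sum>e\<le>n. f d e) = (\<Sum>l = r..m * n. \<Sum>d | d dvd l. f d (l div d))"
proof -
  let ?P = "{(d, e). d * e \<in> {r..m * n}}"
  have "d \<le> d * e \<and> e \<le> d * e" if "d * e \<ge> r" for d e :: nat
    using that \<open>r > 0\<close> by (cases d; cases e) auto
  then have "d \<le> m * n \<and> e \<le> m * n" if "d * e \<ge> r" "d * e \<le> m * n" for d e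
    using that le_trans by meson
  then have "?P \<subseteq> {..m * n} \<times> {..m * n}"
    by auto
  then have finP: "finite ?P"
    by (rule finite_subset) simp
  have "(\<Sum>d\<le>m. \<Sum>e\<le>n. f d e) = (\<Sum>(d, e)\<in>{..m} \<times> {..n}. f d e)"
    by (simp add: sum.cartesian_product)
  also have "\<dots> = (\<Sum>(d, e)\<in>?P. f d e)"
  proof (rule sum.mono_neutral_cong)
    show "(case p of (d, e) \<Rightarrow> f d e) = 0" if "p \<in> {..m} \<times> {..n} - ?P" for p
      using that by (auto intro!: small simp: not_le mult_le_mono)
    show "(case p of (d, e) \<Rightarrow> f d e) = 0" if "p \<in> ?P - {..m} \<times> {..n}" for p
      using that by (auto intro!: large)
  qed (use finP in auto)
  also have "\<dots> = (\<Sum>(l, d)\<in>Sigma {r..m * n} (\<lambda>l. {d. d dvd l}). f d (l div d))"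
    by (rule sum.reindex_bij_witness[where i = "\<lambda>(l, d). (d, l div d)" and j = "\<lambda>(d, e). (d * e, d)"])
      (use \<open>r > 0\<close> in auto)
  also have "\<dots> = (\<Sum>l = r..m * n. \<Sum>d | d dvd l. f d (l div d))"
    using \<open>r > 0\<close> by (intro sum.Sigma[symmetric]) auto
  finally show ?thesis .
qed

theorem theorem5p3:
  fixes m n r :: nat
  assumes "m > 0" and "n > 0" and "r > 0"
  shows "((\<lambda>l. \<Sum>d | d dvd l.
            (-1 :: real) powi (int (n + m) - int (d + l div d)) *
            real (m choose d) * real (n choose (l div d)) * real (l choose r))
          has_sum real (M m n r)) {r..}"
proof -
  define f where "f d e = (-1 :: real) powi (int (n + m) - int (d + e)) *
    real (m choose d) * real (n choose e) * real ((d * e) choose r)" for d e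
  let ?F = "\<lambda>l. \<Sum>d | d dvd l. f d (l div d)"
  \<comment> \<open>Inside the box the exponents \<open>m - d\<close> and \<open>n - e\<close> do not truncate, so the two signs of the
    inclusion-exclusion combine into one integer power.\<close>
  have sgn: "(-1 :: real) ^ (m - d) * (-1) ^ (n - e) = (-1) powi (int (n + m) - int (d + e))"
    if "d \<le> m" "e \<le> n" for d e
  proof -
    have "int (n + m) - int (d + e) = int ((m - d) + (n - e))"
      using that by simp
    then show ?thesis
      by (simp only: power_int_of_nat power_add)
  qed
  let ?g = "\<lambda>d e. (-1 :: real) ^ (m - d) * (-1) ^ (n - e) * real ((d * e) choose r)"
  have "real (M m n r) = (\<Sum>T\<in>Pow {..<m}. \<Sum>U\<in>Pow {..<n}. ?g (card T) (card U))"
    by (simp add: M_eq_card_relations card_relations_full_projections)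
  also have "\<dots> = (\<Sum>T\<in>Pow {..<m}. \<Sum>e\<le>n. real (n choose e) * ?g (card T) e)"
    using sum_Pow_by_card[of "{..<n}" "?g d" for d] by (intro sum.cong refl) simp
  also have "\<dots> = (\<Sum>d\<le>m. real (m choose d) * (\<Sum>e\<le>n. real (n choose e) * ?g d e))"
    using sum_Pow_by_card[of "{..<m}" "\<lambda>d. \<Sum>e\<le>n. real (n choose e) * ?g d e"] by simp
  also have "\<dots> = (\<Sum>d\<le>m. \<Sum>e\<le>n. f d e)"
    unfolding sum_distrib_left by (intro sum.cong refl) (simp add: f_def sgn mult_ac)
  also have "\<dots> = (\<Sum>l = r..m * n. ?F l)"
    using \<open>r > 0\<close> by (intro sum_box_eq_sum_divisors) (auto simp: f_def)
  finally have M: "real (M m n r) = (\<Sum>l = r..m * n. ?F l)" .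
  have zero: "?F l = 0" if "l > m * n" for l
  proof (rule sum.neutral, safe)
    fix d assume "d dvd l"
    then have "d * (l div d) > m * n"
      using that by simp
    then have "d > m \<or> l div d > n"
      by (meson linorder_not_le mult_le_mono)
    then show "f d (l div d) = 0"
      by (auto simp: f_def)
  qed
  have "(?F has_sum real (M m n r)) {r..m * n}"
    unfolding M by (intro has_sum_finite) simp
  then have "(?F has_sum real (M m n r)) {r..}"
    by (subst has_sum_cong_neutral[where T = "{r..m * n}" and g = ?F]) (auto intro: zero)
  then show ?thesis
    by (rule has_sum_cong[THEN iffD1, rotated]) (auto simp: f_def intro!: sum.cong)
qed

end
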